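(* If $n$ is a positive integer and $r$, $s$ and $j$ are any integers, then \[ 10\sum_{k = 0}^n \binom{2n}{2k}F_{j(2k + r)} F_{j(2k + s)} = \left( L_j^{2n} + 5^n F_j^{2n} \right)L_{j(2n + r + s)} - ( - 1)^{js} 4^{n} L_{j(r - s)}, \] \[ 2\sum_{k = 0}^n \binom{2n}{2k}L_{j(2k + r)} F_{j(2k + s)} = (L_j^{2n} + 5^n F_j^{2n}) F_{j(2n + r + s)} - ( - 1)^{js} 4^{n} F_{j(r - s)}, \] \[ 2\sum_{k = 0}^n \binom{2n}{2k}L_{j(2k + r)} L_{j(2k + s)} = (L_j^{2n} + 5^n F_j^{2n}) L_{j(2n + r + s)} + ( - 1)^{js} 4^{n} L_{j(r - s)}, \] \[ 10\sum_{k = 0}^{n - 1} \binom{2n - 1}{2k} F_{j(2k + r)} F_{j(2k + s)} = ( - 1)^j L_j^{2n - 1} L_{j(2n + r + s - 1)} - ( - 1)^j 5^n F_j^{2n - 1} F_{j(2n + r + s - 1)}- ( - 1)^{js} 2^{2n - 1} L_{j(r - s)}, \] \[ 2\sum_{k = 0}^{n - 1} \binom{2n - 1}{2k}L_{j(2k + r)} F_{j(2k + s)} = ( - 1)^j L_j^{2n - 1} F_{j(2n + r + s - 1)} - ( - 1)^j 5^{n - 1} F_j^{2n - 1} L_{j(2n + r + s - 1)} - ( - 1)^{js} 2^{2n - 1} F_{j(r - s)}, \] \[ 2\sum_{k = 0}^{n - 1} \binom{2n - 1}{2k}L_{j(2k + r)} L_{j(2k + s)} = ( - 1)^j L_j^{2n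 - 1} L_{j(2n + r + s - 1)} - ( - 1)^j 5^n F_j^{2n - 1} F_{j(2n + r + s - 1)} + ( - 1)^{js} 2^{2n - 1} L_{j(r - s)}. \]
   Context: The Fibonacci numbers $F_j$ and Lucas numbers $L_j$ are defined for all integers $j$ by $F_0=0$, $F_1=1$, $L_0=2$, $L_1=1$, $F_j=F_{j-1}+F_{j-2}$, $L_j=L_{j-1}+L_{j-2}$, with $F_{-j}=(-1)^{j-1}F_j$ and $L_{-j}=(-1)^jL_j$. *)

theory Defs
  imports Complex_Main "HOL-Number_Theory.Fib"
begin

fun lucas :: "nat \<Rightarrow> nat" where
  "lucas 0 = 2"
| "lucas (Suc 0) = 1"
| "lucas (Suc (Suc n)) = lucas (Suc n) + lucas n"

definition fib_int :: "int \<Rightarrow> int" where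
  "fib_int j = (if 0 \<le> j then int (fib (nat j))
                else (-1) ^ (nat (- j) - 1) * int (fib (nat (- j))))"

definition lucas_int :: "int \<Rightarrow> int" where
  "lucas_int j = (if 0 \<le> j then int (lucas (nat j))
                  else (-1) ^ nat (- j) * int (lucas (nat (- j))))"

lemma fib_int_0: "fib_int 0 = 0" and fib_int_1: "fib_int 1 = 1"
  by (simp_all add: fib_int_def)

lemma lucas_int_0: "lucas_int 0 = 2" and lucas_int_1: "lucas_int 1 = 1"
  by (simp_all add: lucas_int_def)

lemma fib_int_rec: "fib_int j = fib_int (j - 1) + fib_int (j - 2)"
proof -
  consider (ge) m where "j = int (Suc (Suc m))" | "j = 1" | "j = 0" | (neg) m where "j = - int (Suc m)"
  proof -
    have "j = int (Suc (Suc (nat (j - 2)))) \<or> j = 1 \<or> j = 0 \<or> j = - int (Suc (nat (- j - 1)))"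
      by linarith
    then show ?thesis using that by blast
  qed
  then show ?thesis
  proof cases
    case ge
    have "nat j = Suc (Suc m)" "nat (j - 1) = Suc m" "nat (j - 2) = m" "0 \<le> j - 2"
      using ge by auto
    then show ?thesis by (simp add: fib_int_def)
  next
    case neg
    have "nat (- j) = Suc m" "nat (- (j - 1)) = Suc (Suc m)" "nat (- (j - 2)) = Suc (Suc (Suc m))" "j < 0"
      using neg by auto
    then show ?thesis by (simp add: fib_int_def algebra_simps)
  qed (simp_all add: fib_int_def numeral_2_eq_2)
qed

lemma lucas_int_rec: "lucas_int j = lucas_int (j - 1) + lucas_int (j - 2)"
proof -
  consider (ge) m where "j = int (Suc (Suc m))" | "j = 1" | "j = 0" | (neg) m where "j = - int (Suc m)"
  proof -
    have "j = int (Suc (Suc (nat (j - 2)))) \<or> j = 1 \<or> j = 0 \<or> j = - int (Suc (nat (- j - 1)))"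
      by linarith
    then show ?thesis using that by blast
  qed
  then show ?thesis
  proof cases
    case ge
    have "nat j = Suc (Suc m)" "nat (j - 1) = Suc m" "nat (j - 2) = m" "0 \<le> j - 2"
      using ge by auto
    then show ?thesis by (simp add: lucas_int_def)
  next
    case neg
    have "nat (- j) = Suc m" "nat (- (j - 1)) = Suc (Suc m)" "nat (- (j - 2)) = Suc (Suc (Suc m))" "j < 0"
      using neg by auto
    then show ?thesis by (simp add: lucas_int_def algebra_simps)
  qed (simp_all add: lucas_int_def numeral_2_eq_2)
qed

end

theory Submission
  imports Defs
begin

text \<open>By Binet's formulas, \<open>lucas_int m\<close> and \<open>sqrt 5 * fib_int m\<close> are the values of \<open>\<alpha>\<^sup>m + u \<beta>\<^sup>m\<close>
  at \<open>u = 1\<close> and \<open>u = -1\<close>, so all six sums are instances of one bilinear sum. Expanding the product,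
  the mixed terms depend on \<open>k\<close> only through \<open>(\<alpha>\<beta>)\<^sup>2\<^sup>j\<^sup>k = 1\<close>, while the pure terms are
  even parts of binomial expansions, \<open>(1 + A\<^sup>2)\<^sup>N + (1 - A\<^sup>2)\<^sup>N\<close> with \<open>A = \<alpha>\<^sup>j\<close>.
  Since \<open>A B = \<plusminus>1\<close> for \<open>B = \<beta>\<^sup>j\<close>, both \<open>1 + A\<^sup>2\<close> and \<open>1 - A\<^sup>2\<close> are, up to sign, \<open>A\<close> times one of
  \<open>A + B = lucas_int j\<close> and \<open>A - B = sqrt 5 * fib_int j\<close>.\<close>

section \<open>Two-term recurrences over the integers\<close>

lemma int_two_step_induct:
  fixes P :: "int \<Rightarrow> bool"
  assumes "P 0" "P 1"
    and up: "\<And>i. P i \<Longrightarrow> P (i + 1) \<Longrightarrow> P (i + 2)"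
    and down: "\<And>i. P i \<Longrightarrow> P (i + 1) \<Longrightarrow> P (i - 1)"
  shows "P m"
proof -
  have "P m \<and> P (m + 1)"
  proof (induction m rule: int_induct[where k = 0])
    case (step1 i)
    then show ?case using up[of i] by (simp add: add.assoc)
  next
    case (step2 i)
    then show ?case using down[of i] by simp
  qed (use assms in simp_all)
  then show ?thesis by simp
qed

text \<open>The recurrence at \<open>i + 2\<close> yields the next value and at
  \<open>i + 1\<close>, solved for \<open>f (i - 1)\<close>, the previous one. Binet's formulas thus
  follow at negative indices without a case split on the sign.\<close>

lemma fibonacci_recurrence_eqI:
  fixes f g :: "int \<Rightarrow> 'a::ab_group_add"
  assumes f: "\<And>i. f i = f (i - 1) + f (i - 2)" and g: "\<And>i. g i = g (i - 1) + g (i - 2)"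
    and "f 0 = g 0" "f 1 = g 1"
  shows "f m = g m"
proof (induction m rule: int_two_step_induct)
  case (3 i)
  then show ?case using f[of "i + 2"] g[of "i + 2"] by (simp add: algebra_simps)
next
  case (4 i)
  then show ?case using f[of "i + 1"] g[of "i + 1"] by (simp add: algebra_simps)
qed (use assms(3,4) in simp_all)

section \<open>The golden ratio and Binet's formulas\<close>

definition golden :: real where "golden = (1 + sqrt 5) / 2"

definition golden_conj :: real where "golden_conj = (1 - sqrt 5) / 2"

lemma golden_mult_conj: "golden * golden_conj = -1"
  by (simp add: golden_def golden_conj_def field_simps)

lemma golden_nonzero [simp]: "golden \<noteq> 0" "golden_conj \<noteq> 0"
  using golden_mult_conj by auto

lemma golden_diff: "golden - golden_conj = sqrt 5"
  by (simp add: golden_def golden_conj_def field_simps)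

lemma golden_squared: "golden\<^sup>2 = golden + 1" "golden_conj\<^sup>2 = golden_conj + 1"
  by (simp_all add: golden_def golden_conj_def power2_eq_square field_simps)

lemma power_int_fibonacci_recurrence:
  fixes x :: real
  assumes "x\<^sup>2 = x + 1" "x \<noteq> 0"
  shows "x powi i = x powi (i - 1) + x powi (i - 2)"
proof -
  have "x powi i = x powi (i - 2) * x\<^sup>2"
    using assms(2) power_int_add[of x "i - 2" 2] by simp
  moreover have "x powi (i - 1) = x powi (i - 2) * x"
    using assms(2) power_int_add[of x "i - 2" 1] by simp
  ultimately show ?thesis using assms(1) by (simp add: algebra_simps)
qed

text \<open>The coefficient \<open>u\<close> stays a parameter because the pure terms in a product
  of \<open>binet u\<close> and \<open>binet v\<close> carry the coefficients 1 and
  \<open>u * v\<close>, so they again form a \<open>binet\<close>.\<close>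

definition binet :: "real \<Rightarrow> int \<Rightarrow> real" where
  "binet u m = golden powi m + u * golden_conj powi m"

lemma binet_rec: "binet u i = binet u (i - 1) + binet u (i - 2)"
  unfolding binet_def
  by (subst (1 2) power_int_fibonacci_recurrence)
     (simp_all add: golden_squared algebra_simps)

lemma binet_lucas: "binet 1 m = lucas_int m"
proof (rule fibonacci_recurrence_eqI[where f = "binet 1" and g = "\<lambda>m. real_of_int (lucas_int m)"])
  show "real_of_int (lucas_int i) = real_of_int (lucas_int (i - 1)) + real_of_int (lucas_int (i - 2))" for i
    by (subst lucas_int_rec) simp
  show "binet 1 1 = lucas_int 1"
    by (simp add: binet_def golden_def golden_conj_def lucas_int_1 field_simps)
qed (rule binet_rec, simp add: binet_def lucas_int_0)

lemma binet_fib: "binet (-1) m = sqrt 5 * fib_int m"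
proof (rule fibonacci_recurrence_eqI[where f = "binet (-1)" and g = "\<lambda>m. sqrt 5 * real_of_int (fib_int m)"])
  show "sqrt 5 * fib_int i = sqrt 5 * fib_int (i - 1) + sqrt 5 * fib_int (i - 2)" for i
    by (subst fib_int_rec) (simp add: algebra_simps)
qed (rule binet_rec, simp_all add: binet_def fib_int_0 fib_int_1 golden_diff)

section \<open>Binomial sums over even indices\<close>

lemma sum_choose_even_powers:
  fixes x :: "'a::comm_ring_1"
  shows "2 * (\<Sum>k = 0..N div 2. of_nat (N choose (2 * k)) * x ^ (2 * k)) = (1 + x) ^ N + (1 - x) ^ N"
proof -
  have "(1 + x) ^ N + (1 - x) ^ N = (\<Sum>k\<le>N. of_nat (N choose k) * (x ^ k + (-x) ^ k))"
    using binomial_ring[of x 1 N] binomial_ring[of "-x" 1 N]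
    by (simp add: add.commute sum.distrib algebra_simps)
  \<comment> \<open>Odd powers cancel between the two expansions; the even indices up to
    \<open>N\<close> are the doubles of \<open>0..N div 2\<close>.\<close>
  also have "\<dots> = (\<Sum>k\<in>(*) 2 ` {0..N div 2}. of_nat (N choose k) * (x ^ k + (-x) ^ k))"
  proof (rule sum.mono_neutral_right)
    show "\<forall>k\<in>{..N} - (*) 2 ` {0..N div 2}. of_nat (N choose k) * (x ^ k + (-x) ^ k) = 0"
    proof
      fix k assume k: "k \<in> {..N} - (*) 2 ` {0..N div 2}"
      have "odd k"
      proof
        assume "even k"
        then obtain i where "k = 2 * i" by blast
        with k show False by auto
      qed
      then show "of_nat (N choose k) * (x ^ k + (-x) ^ k) = 0" by simp
    qed
  qed auto
  also have "\<dots> = (\<Sum>k = 0..N div 2. of_nat (N choose (2 * k)) * (2 * x ^ (2 * k)))"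
    by (subst sum.reindex) (auto simp: inj_on_def)
  finally show ?thesis
    by (simp add: sum_distrib_left mult.left_commute)
qed

lemma sum_choose_bilinear:
  fixes A B :: "'a::comm_ring_1"
  assumes "(A * B)\<^sup>2 = 1" "N > 0"
  shows "2 * (\<Sum>k = 0..N div 2. of_nat (N choose (2 * k)) *
              ((A ^ (2 * k) * p + u * (B ^ (2 * k) * q)) * (A ^ (2 * k) * p' + v * (B ^ (2 * k) * q'))))
     = ((1 + A\<^sup>2) ^ N + (1 - A\<^sup>2) ^ N) * (p * p') + u * v * ((1 + B\<^sup>2) ^ N + (1 - B\<^sup>2) ^ N) * (q * q')
       + 2 ^ N * (v * (p * q') + u * (q * p'))" (is "2 * ?S = _")
proof -
  let ?s = "\<lambda>x. \<Sum>k = 0..N div 2. of_nat (N choose (2 * k)) * x ^ (2 * k)"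
  \<comment> \<open>The constant mixed term is written with \<open>1 ^ (2 * k)\<close> so that all
    three resulting sums are values of \<open>?s\<close>.\<close>
  have "(A ^ (2 * k) * p + u * (B ^ (2 * k) * q)) * (A ^ (2 * k) * p' + v * (B ^ (2 * k) * q'))
      = (A\<^sup>2) ^ (2 * k) * (p * p') + (B\<^sup>2) ^ (2 * k) * (u * v * (q * q'))
        + 1 ^ (2 * k) * (v * (p * q') + u * (q * p'))" for k
  proof -
    have "A ^ (2 * k) * B ^ (2 * k) = 1"
      using assms(1) by (metis power_mult power_mult_distrib power_one)
    moreover have "(A\<^sup>2) ^ (2 * k) = A ^ (2 * k) * A ^ (2 * k)" "(B\<^sup>2) ^ (2 * k) = B ^ (2 * k) * B ^ (2 * k)"
      by (simp_all add: power_mult[symmetric] power_add[symmetric] mult_2)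
    moreover have "(a * p + u * (b * q)) * (a * p' + v * (b * q'))
        = a * a * (p * p') + b * b * (u * v * (q * q')) + a * b * (v * (p * q') + u * (q * p'))" for a b :: 'a
      by (simp add: algebra_simps)
    ultimately show ?thesis by simp
  qed
  then have "?S = ?s (A\<^sup>2) * (p * p') + ?s (B\<^sup>2) * (u * v * (q * q')) + ?s 1 * (v * (p * q') + u * (q * p'))"
    by (simp only: distrib_left mult.assoc sum.distrib sum_distrib_right)
  then have "2 * ?S = 2 * ?s (A\<^sup>2) * (p * p') + 2 * ?s (B\<^sup>2) * (u * v * (q * q'))
      + 2 * ?s 1 * (v * (p * q') + u * (q * p'))"
    by (simp only: distrib_left mult.assoc)
  then show ?thesis
    \<comment> \<open>At \<open>x = 1\<close> the even-power sum is \<open>2 ^ N + 0 ^ N\<close>,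
      and \<open>N > 0\<close> removes the second term.\<close>
    using assms(2) unfolding sum_choose_even_powers by (simp add: algebra_simps power_0_left)
qed

text \<open>Replace 1 by \<open>A * B\<close> or \<open>- (A * B)\<close> and factor out
  \<open>A\<close>. Passing from \<open>e = 1\<close> to \<open>e = -1\<close> swaps
  \<open>A + B\<close> and \<open>A - B\<close>, which is invisible for even \<open>N\<close> and
  gives the factor \<open>e\<close> for odd \<open>N\<close>.\<close>

lemma one_plus_minus_square_factor:
  fixes A B e :: "'a::comm_ring_1"
  assumes "A * B = e" "e = 1 \<or> e = -1"
  shows "even N \<Longrightarrow> (1 + A\<^sup>2) ^ N + (1 - A\<^sup>2) ^ N = A ^ N * ((A + B) ^ N + (A - B) ^ N)"
    and "odd N \<Longrightarrow> (1 + A\<^sup>2) ^ N + (1 - A\<^sup>2) ^ N = e * A ^ N * ((A + B) ^ N - (A - B) ^ N)"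
proof -
  consider "e = 1" "1 + A\<^sup>2 = A * (A + B)" "1 - A\<^sup>2 = - (A * (A - B))"
    | "e = -1" "1 + A\<^sup>2 = A * (A - B)" "1 - A\<^sup>2 = - (A * (A + B))"
    using assms by (auto simp: power2_eq_square algebra_simps)
  note cs = this
  show "(1 + A\<^sup>2) ^ N + (1 - A\<^sup>2) ^ N = A ^ N * ((A + B) ^ N + (A - B) ^ N)" if "even N"
    using cs by cases (simp_all only: power_minus_even[OF that] power_mult_distrib, simp_all add: algebra_simps)
  show "(1 + A\<^sup>2) ^ N + (1 - A\<^sup>2) ^ N = e * A ^ N * ((A + B) ^ N - (A - B) ^ N)" if "odd N"
    using cs by cases (simp_all only: power_minus_odd[OF that] power_mult_distrib, simp_all add: algebra_simps)
qed

section \<open>The bilinear sum in terms of \<open>binet\<close>\<close>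

lemma golden_mult_conj_powi: "golden powi m * golden_conj powi m = (-1) powi m"
  by (simp add: power_int_mult_distrib[symmetric] golden_mult_conj)

lemma golden_powi_mixed:
  "golden powi (j * r) * golden_conj powi (j * s) = (-1) powi (j * s) * golden powi (j * (r - s))"
  "golden_conj powi (j * r) * golden powi (j * s) = (-1) powi (j * s) * golden_conj powi (j * (r - s))"
  using power_int_add[of golden "j * s" "j * (r - s)"] power_int_add[of golden_conj "j * s" "j * (r - s)"]
  by (simp_all add: golden_mult_conj_powi[symmetric] algebra_simps)

lemma power_int_mult_add:
  fixes x :: real
  assumes "x \<noteq> 0"
  shows "x powi (j * (int N + t)) = (x powi j) ^ N * x powi (j * t)"
  using assms power_int_mult[of x j "int N"] by (simp add: distrib_left power_int_add)

text \<open>Separates the dependence on \<open>k\<close> from the constant factors, giving the shape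
  summed by \<open>sum_choose_bilinear\<close>.\<close>

lemma binet_shift:
  "binet u (j * (2 * int k + r)) =
     (golden powi j) ^ (2 * k) * golden powi (j * r) + u * ((golden_conj powi j) ^ (2 * k) * golden_conj powi (j * r))"
  using power_int_mult_add[of golden j "2 * k" r] power_int_mult_add[of golden_conj j "2 * k" r]
  by (simp add: binet_def)

lemma binet_add:
  "(golden powi j) ^ N * (golden powi (j * r) * golden powi (j * s))
     + u * ((golden_conj powi j) ^ N * (golden_conj powi (j * r) * golden_conj powi (j * s)))
   = binet u (j * (int N + r + s))"
  by (simp add: binet_def add.assoc power_int_mult_add distrib_left[of j r s] power_int_add)

lemma sum_choose_binet:
  assumes "N > 0" "v * v = 1"
  shows
    "even N \<Longrightarrow>
       2 * (\<Sum>k = 0..N div 2. real (N choose (2 * k)) * (binet u (j * (2 * int k + r)) * binet v (j * (2 * int k + s))))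
       = (binet 1 j ^ N + binet (-1) j ^ N) * binet (u * v) (j * (int N + r + s))
         + (-1) powi (j * s) * 2 ^ N * v * binet (u * v) (j * (r - s))" (is "_ \<Longrightarrow> ?even")
    and "odd N \<Longrightarrow>
       2 * (\<Sum>k = 0..N div 2. real (N choose (2 * k)) * (binet u (j * (2 * int k + r)) * binet v (j * (2 * int k + s))))
       = (-1) powi j * (binet 1 j ^ N * binet (u * v) (j * (int N + r + s))
                        - binet (-1) j ^ N * binet (- (u * v)) (j * (int N + r + s)))
         + (-1) powi (j * s) * 2 ^ N * v * binet (u * v) (j * (r - s))" (is "_ \<Longrightarrow> ?odd")
proof -
  define A B where "A = golden powi j" and "B = golden_conj powi j"
  let ?p = "golden powi (j * r) * golden powi (j * s)"
  let ?q = "golden_conj powi (j * r) * golden_conj powi (j * s)"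
  let ?e = "(-1 :: real) powi j"
  have AB: "A * B = ?e" "B * A = ?e"
    by (simp_all add: A_def B_def golden_mult_conj_powi mult.commute)
  have e: "?e = 1 \<or> ?e = -1"
    by (simp add: power_int_minus_left)
  have "(A * B)\<^sup>2 = 1"
    using AB e by auto
  note main = sum_choose_bilinear[OF this \<open>N > 0\<close>, of "golden powi (j * r)" u "golden_conj powi (j * r)"
      "golden powi (j * s)" v "golden_conj powi (j * s)"]
  have mixed: "v * (golden powi (j * r) * golden_conj powi (j * s)) + u * (golden_conj powi (j * r) * golden powi (j * s))
      = (-1) powi (j * s) * v * binet (u * v) (j * (r - s))"
  proof -
    \<comment> \<open>Since \<open>v * v = 1\<close>, both mixed terms share the factor
      \<open>v\<close>, and what remains is a \<open>binet\<close> with coefficient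
      \<open>u * v\<close>.\<close>
    have "u = v * (u * v)" using assms(2) by (simp add: mult.left_commute)
    then show ?thesis unfolding golden_powi_mixed binet_def by algebra
  qed
  \<comment> \<open>The sign of \<open>B - A\<close> survives odd powers only; this is why
    \<open>binet (- (u * v))\<close> appears for odd \<open>N\<close>.\<close>
  have l: "A + B = binet 1 j" "B + A = binet 1 j" "A - B = binet (-1) j" "B - A = - binet (-1) j"
    by (simp_all add: A_def B_def binet_def)
  have shift: "A ^ N * ?p + w * (B ^ N * ?q) = binet w (j * (int N + r + s))" for w
    unfolding A_def B_def by (rule binet_add)
  note expand = main[unfolded A_def B_def, folded binet_shift, folded A_def B_def, unfolded mixed]
  show ?even if "even N"
    unfolding expand one_plus_minus_square_factor(1)[OF AB(1) e that]
      one_plus_minus_square_factor(1)[OF AB(2) e that] l power_minus_even[OF that] shift[symmetric]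
    by algebra
  show ?odd if "odd N"
    unfolding expand one_plus_minus_square_factor(2)[OF AB(1) e that]
      one_plus_minus_square_factor(2)[OF AB(2) e that] l power_minus_odd[OF that] shift[symmetric]
    by algebra
qed

section \<open>Specialization to Fibonacci and Lucas numbers\<close>

lemma sqrt_5_power_even: "(sqrt 5 * x) ^ (2 * n) = 5 ^ n * x ^ (2 * n)"
  by (simp add: power_mult_distrib power_mult)

lemma sqrt_5_power_odd: "n > 0 \<Longrightarrow> (sqrt 5 * x) ^ (2 * n - 1) = sqrt 5 * (5 ^ (n - 1) * x ^ (2 * n - 1))"
  by (cases n) (simp_all add: power_mult_distrib power_mult)

theorem theorem27:
  fixes n :: nat and r s j :: int
  assumes "n > 0"
  shows
    "(10 * (\<Sum>k = 0..n. ((2 * n) choose (2 * k)) * fib_int (j * (2 * int k + r)) * fib_int (j * (2 * int k + s))) :: real)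
      = (lucas_int j ^ (2 * n) + 5 ^ n * fib_int j ^ (2 * n)) * lucas_int (j * (2 * int n + r + s))
        - (-1) powi (j * s) * 4 ^ n * lucas_int (j * (r - s))
   \<and> (2 * (\<Sum>k = 0..n. ((2 * n) choose (2 * k)) * lucas_int (j * (2 * int k + r)) * fib_int (j * (2 * int k + s))) :: real)
      = (lucas_int j ^ (2 * n) + 5 ^ n * fib_int j ^ (2 * n)) * fib_int (j * (2 * int n + r + s))
        - (-1) powi (j * s) * 4 ^ n * fib_int (j * (r - s))
   \<and> (2 * (\<Sum>k = 0..n. ((2 * n) choose (2 * k)) * lucas_int (j * (2 * int k + r)) * lucas_int (j * (2 * int k + s))) :: real)
      = (lucas_int j ^ (2 * n) + 5 ^ n * fib_int j ^ (2 * n)) * lucas_int (j * (2 * int n + r + s))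
        + (-1) powi (j * s) * 4 ^ n * lucas_int (j * (r - s))
   \<and> (10 * (\<Sum>k = 0..n - 1. ((2 * n - 1) choose (2 * k)) * fib_int (j * (2 * int k + r)) * fib_int (j * (2 * int k + s))) :: real)
      = (-1) powi j * lucas_int j ^ (2 * n - 1) * lucas_int (j * (2 * int n + r + s - 1))
        - (-1) powi j * 5 ^ n * fib_int j ^ (2 * n - 1) * fib_int (j * (2 * int n + r + s - 1))
        - (-1) powi (j * s) * 2 ^ (2 * n - 1) * lucas_int (j * (r - s))
   \<and> (2 * (\<Sum>k = 0..n - 1. ((2 * n - 1) choose (2 * k)) * lucas_int (j * (2 * int k + r)) * fib_int (j * (2 * int k + s))) :: real)
      = (-1) powi j * lucas_int j ^ (2 * n - 1) * fib_int (j * (2 * int n + r + s - 1))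
        - (-1) powi j * 5 ^ (n - 1) * fib_int j ^ (2 * n - 1) * lucas_int (j * (2 * int n + r + s - 1))
        - (-1) powi (j * s) * 2 ^ (2 * n - 1) * fib_int (j * (r - s))
   \<and> (2 * (\<Sum>k = 0..n - 1. ((2 * n - 1) choose (2 * k)) * lucas_int (j * (2 * int k + r)) * lucas_int (j * (2 * int k + s))) :: real)
      = (-1) powi j * lucas_int j ^ (2 * n - 1) * lucas_int (j * (2 * int n + r + s - 1))
        - (-1) powi j * 5 ^ n * fib_int j ^ (2 * n - 1) * fib_int (j * (2 * int n + r + s - 1))
        + (-1) powi (j * s) * 2 ^ (2 * n - 1) * lucas_int (j * (r - s))"
proof -
  have sqrt5: "sqrt 5 * (sqrt 5 * x) = 5 * x" for x :: real
    by simp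
  \<comment> \<open>Each Fibonacci factor contributes one \<open>sqrt 5\<close>: two of them turn
    the coefficient 2 into 10, while a single one is a common factor of both sides, removed by
    \<open>cancel\<close>.\<close>
  have FF: "(\<Sum>k = 0..M. real (N choose (2 * k)) * (binet (-1) (j * (2 * int k + r)) * binet (-1) (j * (2 * int k + s))))
      = 5 * real_of_int (\<Sum>k = 0..M. (N choose (2 * k)) * fib_int (j * (2 * int k + r)) * fib_int (j * (2 * int k + s)))"
    for M N
    by (simp add: binet_fib sum_distrib_left algebra_simps sqrt5)
  have LF: "(\<Sum>k = 0..M. real (N choose (2 * k)) * (binet 1 (j * (2 * int k + r)) * binet (-1) (j * (2 * int k + s))))
      = sqrt 5 * real_of_int (\<Sum>k = 0..M. (N choose (2 * k)) * lucas_int (j * (2 * int k + r)) * fib_int (j * (2 * int k + s)))"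
    for M N
    by (simp add: binet_fib binet_lucas sum_distrib_left algebra_simps)
  have LL: "(\<Sum>k = 0..M. real (N choose (2 * k)) * (binet 1 (j * (2 * int k + r)) * binet 1 (j * (2 * int k + s))))
      = real_of_int (\<Sum>k = 0..M. (N choose (2 * k)) * lucas_int (j * (2 * int k + r)) * lucas_int (j * (2 * int k + s)))"
    for M N
    by (simp add: binet_lucas algebra_simps)
  have "2 * n > 0" "even (2 * n)" "2 * n div 2 = n" "int (2 * n) = 2 * int n" "(2::real) ^ (2 * n) = 4 ^ n"
    using assms by (auto simp: power_mult)
  note even = sum_choose_binet(1)[of "2 * n", OF this(1) _ this(2), where j = j and r = r and s = s, unfolded this(3-5)]
  have "2 * n - 1 > 0" "odd (2 * n - 1)" "(2 * n - 1) div 2 = n - 1"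
    "int (2 * n - 1) + r + s = 2 * int n + r + s - 1"
    using assms by auto
  note odd = sum_choose_binet(2)[of "2 * n - 1", OF this(1) _ this(2), where j = j and r = r and s = s, unfolded this(3,4)]
  \<comment> \<open>For odd exponents, \<open>fib_int j\<close> leaves
    \<open>sqrt 5 * 5 ^ (n - 1)\<close>. When \<open>u * v = 1\<close> it meets the
    \<open>sqrt 5\<close> of \<open>binet (-1)\<close>, which completes
    \<open>5 ^ n\<close>.\<close>
  have five: "(5::real) ^ n = 5 * 5 ^ (n - 1)"
    using assms by (simp add: power_eq_if)
  have cancel: "x = y" if "sqrt 5 * x = sqrt 5 * y" for x y :: real
    using that by simp
  note signs = minus_mult_minus mult_1_left mult_1_right minus_minus
  note binet = binet_fib binet_lucas sqrt_5_power_even sqrt_5_power_odd[OF assms]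
  show ?thesis
  proof (intro conjI, goal_cases)
    case 1
    show ?case
      using even[where u = "-1" and v = "-1", unfolded FF, unfolded signs binet] by (simp add: algebra_simps sqrt5)
  next
    case 2
    show ?case
      by (rule cancel) (use even[where u = "1" and v = "-1", unfolded LF, unfolded signs binet] in \<open>simp add: algebra_simps sqrt5\<close>)
  next
    case 3
    show ?case
      using even[where u = "1" and v = "1", unfolded LL, unfolded signs binet] by (simp add: algebra_simps sqrt5)
  next
    case 4
    show ?case
      using odd[where u = "-1" and v = "-1", unfolded FF, unfolded signs binet] by (simp add: five algebra_simps sqrt5)
  next
    case 5
    show ?case
      by (rule cancel) (use odd[where u = "1" and v = "-1", unfolded LF, unfolded signs binet] in \<open>simp add: algebra_simps sqrt5\<close>)
  next
    case 6
    show ?case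
      using odd[where u = "1" and v = "1", unfolded LL, unfolded signs binet] by (simp add: five algebra_simps sqrt5)
  qed
qed

end
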